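(* Let $n,k,m$ be integers such that $n\ge 3$, $0\le k\le n-1$, and $0<m\le n-1-k$. If $n+k+m$ is odd, then $$z(n,k,m)=\sum_{f=1}^m \binom{k+f}{f}\binom{m-1}{f-1}\,z(n-m-f,\,k+f,\,0).$$ If $n+k+m$ is even, then $$z(n,k,m)=\sum_{f=1}^m \binom{k+f-1}{f-1}\binom{m-1}{f-1}\,z(n-m-f,\,k+f-1,\,0)+\sum_{f=1}^m \binom{k+f}{f}\binom{m-1}{f-1}\,z(n-m-f,\,k+f,\,0).$$
   Context: A binary string of length $n$ is a sequence $b_1b_2\cdots b_n$ with each $b_i\in\{0,1\}$. A 0-pair (resp. 1-pair) of the string is an index $i$ with $1\le i\le n-1$ and $b_i=b_{i+1}=0$ (resp. $b_i=b_{i+1}=1$); the first and last bits are not considered consecutive. For integers $n\ge 0$ and $k,m\ge 0$, $Z(n,k,m)$ is the set of binary strings of length $n$ whose first bit is 0 and which have exactly $k$ 0-pairs and exactly $m$ 1-pairs, and $z(n,k,m)=|Z(n,k,m)|$ (so $z(0,k,m)=0$, since the empty string has no first bit). By convention $z(n,k,m)=0$ whenever $n<0$, $k<0$ or $m<0$. *)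

theory Defs
  imports Complex_Main
begin

definition binary_string :: "nat list \<Rightarrow> bool" where
  "binary_string b \<longleftrightarrow> set b \<subseteq> {0, 1}"

(* Indices are those of lists: position i here is position i + 1 in the usual numbering
   b_1 ... b_n of the bits. The last and the first bit are not considered consecutive. *)
definition pairs :: "nat \<Rightarrow> nat list \<Rightarrow> nat set" where
  "pairs c b = {i. Suc i < length b \<and> b ! i = c \<and> b ! Suc i = c}"

(* The parameters are integers: the set is empty as soon as one of them is negative. *)
definition Z :: "int \<Rightarrow> int \<Rightarrow> int \<Rightarrow> nat list set" where
  "Z n k m = {b. binary_string b \<and> int (length b) = n \<and> b \<noteq> [] \<and> hd b = 0 \<and>
                 int (card (pairs 0 b)) = k \<and> int (card (pairs 1 b)) = m}"

definition z :: "int \<Rightarrow> int \<Rightarrow> int \<Rightarrow> nat" where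
  "z n k m = card (Z n k m)"

end

theory Submission
  imports Defs
begin

text \<open>
  A binary string that starts with 0 is an alternating sequence of maximal runs: a run of zeros,
  a run of ones, and so on. A run of length \<open>l\<close> contributes \<open>l - 1\<close> pairs, so a string of length
  \<open>n\<close> with \<open>k\<close> 0-pairs and \<open>m\<close> 1-pairs has exactly \<open>t = n - k - m\<close> runs, of which
  \<open>\<lceil>t/2\<rceil>\<close> consist of zeros and \<open>\<lfloor>t/2\<rfloor>\<close> of ones. The string is determined by how
  its \<open>k\<close> 0-pairs are distributed over the former and its \<open>m\<close> 1-pairs over the latter.
  Hence \<open>z(n,k,m)\<close> is a product of two numbers of weak compositions (lemma \<open>z_closed_form\<close>), and
  the parity of \<open>n + k + m\<close>, which is that of \<open>t\<close>, says whether the string ends with a run of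
  zeros or of ones.

  With \<open>r\<close> runs of zeros there are \<open>k + r\<close> zeros, hence \<open>k + r - 1\<close> gaps between consecutive
  zeros. All the values of \<open>z\<close> on the right-hand side have last parameter 0 and count strings
  with this same number of zeros in which every run of ones is a single bit, so they are the plain
  binomial coefficients counting the choices of the gaps that stay empty
  (\<open>z_without_one_pairs\<close>). The number of empty gaps grows from \<open>k\<close> to \<open>k + f\<close> or \<open>k + f - 1\<close>:
  the summation variable \<open>f\<close> is the number of runs of ones that have length at least two; these
  runs are removed, and only one at the very end of the string leaves no empty gap behind.
  The other two factors undo the removal: one chooses which empty gaps had contained long runs,
  the other, \<open>(m - 1) choose (f - 1)\<close>, distributes the \<open>m\<close> 1-pairs over the \<open>f\<close> long runs with
  at least one in each.
  After pulling the choice of the \<open>k\<close> gaps that are empty in the original string out of each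
  summand (\<open>choose_of_choose\<close>), what remains to be summed is Vandermonde's convolution
  (\<open>vandermonde_long_runs\<close>).
\<close>

section \<open>Strings with prescribed numbers of pairs\<close>

lemma pairs_singleton: "pairs c [x] = {}"
  by (simp add: pairs_def)

lemma finite_pairs: "finite (pairs c b)"
  by (rule finite_subset[of _ "{..<length b}"]) (auto simp: pairs_def)

lemma card_pairs_Cons_Cons:
  "card (pairs c (x # y # b)) = card (pairs c (y # b)) + (if x = c \<and> y = c then 1 else 0)"
proof -
  have split: "pairs c (x # y # b)
      = Suc ` pairs c (y # b) \<union> (if x = c \<and> y = c then {0} else {})" (is "?L = ?R")
  proof (rule set_eqI)
    fix i show "i \<in> ?L \<longleftrightarrow> i \<in> ?R"
      by (cases i) (auto simp: pairs_def image_iff)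
  qed
  have "card (Suc ` pairs c (y # b)) = card (pairs c (y # b))"
    by (simp add: card_image)
  then show ?thesis
    unfolding split by (auto simp: finite_pairs)
qed

text \<open>
  The first bit \<open>c\<close> is a parameter, and \<open>k\<close> counts the pairs of the bit that comes first. Deleting
  the first bit of a string may exchange the two bits, and in this form the family is closed
  under that operation.
\<close>
definition strings_from :: "nat \<Rightarrow> nat \<Rightarrow> nat \<Rightarrow> nat \<Rightarrow> nat list set" where
  "strings_from c n k m = {b. binary_string b \<and> length b = n \<and> b \<noteq> [] \<and> hd b = c \<and>
     card (pairs c b) = k \<and> card (pairs (1 - c) b) = m}"

lemma finite_strings_from: "finite (strings_from c n k m)"
proof (rule finite_subset)
  show "strings_from c n k m \<subseteq> {b. set b \<subseteq> {0, 1} \<and> length b = n}"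
    by (auto simp: strings_from_def binary_string_def)
  show "finite {b. set b \<subseteq> {0, 1 :: nat} \<and> length b = n}"
    by (rule finite_lists_length_eq) simp
qed

lemma strings_from_0: "strings_from c 0 k m = {}"
  by (auto simp: strings_from_def)

lemma strings_from_1:
  assumes "c \<in> {0, 1}"
  shows "strings_from c (Suc 0) k m = (if k = 0 \<and> m = 0 then {[c]} else {})"
  using assms
  by (auto simp: strings_from_def binary_string_def length_Suc_conv pairs_singleton)

lemma strings_from_Suc_Suc:
  assumes "c \<in> {0, 1}"
  shows "strings_from c (Suc (Suc n)) k m =
    Cons c ` ((if k = 0 then {} else strings_from c (Suc n) (k - 1) m)
              \<union> strings_from (1 - c) (Suc n) m k)" (is "?L = Cons c ` ?R")
proof (rule set_eqI)
  fix b :: "nat list"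
  show "b \<in> ?L \<longleftrightarrow> b \<in> Cons c ` ?R"
  proof (cases "\<exists>y b'. b = c # y # b'")
    case True
    then obtain y b' where b: "b = c # y # b'" by blast
    have "b \<in> ?L \<longleftrightarrow> y # b' \<in> ?R"
      using assms unfolding b
      by (cases "y = c")
        (auto simp: strings_from_def binary_string_def card_pairs_Cons_Cons)
    then show ?thesis
      unfolding b by auto
  next
    case False
    have "b \<notin> ?L"
    proof
      assume "b \<in> ?L"
      then have "length b = Suc (Suc n)" "hd b = c"
        by (auto simp: strings_from_def)
      then have "\<exists>y b'. b = c # y # b'"
        by (auto simp: length_Suc_conv)
      with False show False ..
    qed
    moreover have "b \<notin> Cons c ` ?R"
    proof
      assume "b \<in> Cons c ` ?R"
      then obtain b' where "b = c # b'" "b' \<in> ?R" by blast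
      then have "b = c # hd b' # tl b'"
        by (cases b') (auto simp: strings_from_def split: if_splits)
      with False show False by blast
    qed
    ultimately show ?thesis by blast
  qed
qed

lemma card_strings_from_Suc_Suc:
  assumes "c \<in> {0, 1}"
  shows "card (strings_from c (Suc (Suc n)) k m) =
    (if k = 0 then 0 else card (strings_from c (Suc n) (k - 1) m))
    + card (strings_from (1 - c) (Suc n) m k)"
proof -
  have "(if k = 0 then {} else strings_from c (Suc n) (k - 1) m)
      \<inter> strings_from (1 - c) (Suc n) m k = {}"
    using assms by (auto simp: strings_from_def)
  then show ?thesis
    using assms
    by (simp add: strings_from_Suc_Suc card_image card_Un_disjoint finite_strings_from)
qed

section \<open>Counting strings by their runs\<close>

text \<open>
  The parts may be 0, and their number is \<open>r\<close>. Truncated subtraction gives the right value for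
  \<open>r = 0\<close> too: 1 if \<open>j = 0\<close>, and 0 otherwise.
\<close>
definition weak_compositions :: "nat \<Rightarrow> nat \<Rightarrow> nat" where
  "weak_compositions j r = (j + r - 1) choose j"

lemma weak_compositions_0_left: "weak_compositions 0 r = 1"
  by (simp add: weak_compositions_def)

lemma weak_compositions_0_right: "weak_compositions j 0 = (if j = 0 then 1 else 0)"
  by (cases j) (simp_all add: weak_compositions_def)

text \<open>Pascal's rule: the first part of a composition is either positive and can be lowered by one,
  or 0 and can be dropped.\<close>
lemma weak_compositions_Suc_Suc:
  "weak_compositions (Suc j) (Suc r) = weak_compositions j (Suc r) + weak_compositions (Suc j) r"
  by (simp add: weak_compositions_def)

text \<open>
  The two factors distribute the pairs of either bit over the runs of that bit. In the induction,
  deleting the first bit either shortens the first run, or removes it when its length is 1 and so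
  lowers the number of runs by one and exchanges the roles of the bits; Pascal's rule for the
  first factor matches these two cases.
\<close>
lemma card_strings_from:
  assumes "c \<in> {0, 1}"
  shows "card (strings_from c n k m) =
    (if k + m < n
     then weak_compositions k ((n - k - m + 1) div 2) * weak_compositions m ((n - k - m) div 2)
     else 0)"
  using assms
proof (induction n arbitrary: c k m)
  case 0
  then show ?case by (simp add: strings_from_0)
next
  case (Suc n)
  show ?case
  proof (cases n)
    case 0
    with Suc.prems show ?thesis
      by (simp add: strings_from_1 weak_compositions_0_left)
  next
    case (Suc l)
    have flip: "1 - c \<in> {0, 1}" by auto
    note IH = Suc.IH[OF Suc.prems] Suc.IH[OF flip]
    have rec: "card (strings_from c (Suc n) k m) =
        (if k = 0 then 0 else card (strings_from c n (k - 1) m))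
        + card (strings_from (1 - c) n m k)"
      using card_strings_from_Suc_Suc[OF Suc.prems] Suc by simp
    show ?thesis
    proof (cases "k + m < Suc n")
      case False
      then show ?thesis unfolding rec IH by auto
    next
      case True
      define t where "t = n - k - m"
      have n: "n = k + m + t" using True by (simp add: t_def)
      show ?thesis
      proof (cases k)
        case 0
        then show ?thesis
          unfolding rec IH using n Suc
          by (auto simp: weak_compositions_0_left weak_compositions_0_right)
      next
        case (Suc j)
        have "card (strings_from c (Suc n) k m) =
            weak_compositions j ((t + 2) div 2) * weak_compositions m ((t + 1) div 2)
            + (if t = 0 then 0 else
               weak_compositions m ((t + 1) div 2) * weak_compositions (Suc j) (t div 2))"
          unfolding rec IH using n Suc by auto
        also have "\<dots> = weak_compositions (Suc j) (Suc (t div 2))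
                          * weak_compositions m ((t + 1) div 2)"
          by (auto simp: weak_compositions_Suc_Suc weak_compositions_0_right algebra_simps)
        finally show ?thesis
          using n Suc by simp
      qed
    qed
  qed
qed

lemma z_closed_form:
  "z n (int k) (int m) =
    (let t = nat (n - int k - int m)
     in if t = 0 then 0
        else weak_compositions k ((t + 1) div 2) * weak_compositions m (t div 2))"
proof (cases "n < 0")
  case True
  then have "Z n (int k) (int m) = {}" by (auto simp: Z_def)
  with True show ?thesis by (simp add: z_def)
next
  case False
  then have "Z n (int k) (int m) = strings_from 0 (nat n) k m"
    by (auto simp: Z_def strings_from_def)
  moreover have "nat n - k - m = nat (n - int k - int m)"
    "k + m < nat n \<longleftrightarrow> nat (n - int k - int m) \<noteq> 0"
    using False by auto
  ultimately show ?thesis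
    by (simp add: z_def card_strings_from Let_def)
qed

text \<open>
  Here \<open>N + 1\<close> is the number of zeros. Without 1-pairs such a string is given by the \<open>K\<close> of the
  \<open>N\<close> gaps between consecutive zeros that stay empty, the others receiving a single 1; with
  \<open>e = 1\<close> the string ends with a 0, with \<open>e = 0\<close> one more 1 follows the last zero.
\<close>
lemma z_without_one_pairs:
  assumes "e \<in> {0, 1}" and "n = 2 * int N + 2 - int K - e"
  shows "z n (int K) 0 = N choose K"
proof (cases "K \<le> N")
  case True
  then obtain d where N: "N = K + d" using le_Suc_ex by blast
  have "nat (n - int K - int 0) = 2 * d + 2 - nat e"
    using assms N by auto
  then have "z n (int K) (int 0) = N choose K"
    unfolding z_closed_form Let_def
    using assms(1) N by (auto simp: weak_compositions_def)
  then show ?thesis by simp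
next
  case False
  then have "nat (n - int K - int 0) = 0"
    using assms by auto
  then have "z n (int K) (int 0) = 0"
    unfolding z_closed_form Let_def by simp
  with False show ?thesis by simp
qed

section \<open>Binomial identities\<close>

text \<open>
  Both sides count pairs of disjoint subsets, of sizes \<open>k\<close> and \<open>f\<close>, of a set with \<open>N\<close> elements.
\<close>
lemma choose_of_choose:
  "((k + f) choose f) * (N choose (k + f)) = (N choose k) * ((N - k) choose f)"
proof (cases "k + f \<le> N")
  case True
  then show ?thesis
    using choose_mult[of k "k + f" N] binomial_symmetric[of f "k + f"] by (simp add: mult.commute)
next
  case False
  then show ?thesis by (cases "k \<le> N") (auto simp: binomial_eq_0)
qed

text \<open>
  The right-hand side distributes \<open>m\<close> pairs over \<open>r\<close> runs; on the left, \<open>f\<close> is the number of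
  runs that receive at least one.
\<close>
lemma vandermonde_long_runs:
  assumes "0 < m"
  shows "(\<Sum>f = 1..m. (r choose f) * ((m - 1) choose (f - 1))) = weak_compositions m r"
proof -
  have "(\<Sum>f = 1..m. (r choose f) * ((m - 1) choose (f - 1)))
      = (\<Sum>f = 1..m. (r choose f) * ((m - 1) choose (m - f)))"
  proof (rule sum.cong[OF refl])
    fix f assume "f \<in> {1..m}"
    then have "f - 1 \<le> m - 1" and "m - 1 - (f - 1) = m - f" by auto
    then show "(r choose f) * ((m - 1) choose (f - 1)) = (r choose f) * ((m - 1) choose (m - f))"
      using binomial_symmetric[of "f - 1" "m - 1"] by (simp only:)
  qed
  also have "\<dots> = (\<Sum>f\<le>m. (r choose f) * ((m - 1) choose (m - f)))"
    \<comment> \<open>The additional summand, for \<open>f = 0\<close>, vanishes because \<open>m\<close> exceeds \<open>m - 1\<close>.\<close>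
    using assms by (intro sum.mono_neutral_left) (auto simp: not_le)
  also have "\<dots> = (r + (m - 1)) choose m"
    by (rule vandermonde)
  also have "\<dots> = weak_compositions m r"
    using assms by (simp add: weak_compositions_def add.commute)
  finally show ?thesis .
qed

lemma sum_choose_long_runs:
  assumes "0 < m"
  shows "(\<Sum>f = 1..m. ((k + f) choose f) * ((m - 1) choose (f - 1)) * (N choose (k + f)))
      = (N choose k) * weak_compositions m (N - k)"
proof -
  have "((k + f) choose f) * ((m - 1) choose (f - 1)) * (N choose (k + f))
      = (N choose k) * (((N - k) choose f) * ((m - 1) choose (f - 1)))" for f
    using choose_of_choose[of k f N] by (simp add: ac_simps)
  then show ?thesis
    by (simp only: sum_distrib_left[symmetric] vandermonde_long_runs[OF assms])
qed

text \<open>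
  For strings that end with a run of ones, the two sums separate the cases where this last run
  has length at least two or one; Pascal's rule merges them.
\<close>
lemma sum_choose_long_runs_final:
  assumes "0 < m" and "k \<le> N"
  shows "(\<Sum>f = 1..m. ((k + f - 1) choose (f - 1)) * ((m - 1) choose (f - 1))
                        * (N choose (k + f - 1)))
       + (\<Sum>f = 1..m. ((k + f) choose f) * ((m - 1) choose (f - 1)) * (N choose (k + f)))
      = (N choose k) * weak_compositions m (Suc (N - k))"
proof -
  have "((k + f - 1) choose (f - 1)) * ((m - 1) choose (f - 1)) * (N choose (k + f - 1))
      + ((k + f) choose f) * ((m - 1) choose (f - 1)) * (N choose (k + f))
      = (N choose k) * ((Suc (N - k) choose f) * ((m - 1) choose (f - 1)))"
    if "f \<in> {1..m}" for f
  proof -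
    from that obtain g where f: "f = Suc g" by (cases f) auto
    have "((k + g) choose g) * (N choose (k + g)) + ((k + f) choose f) * (N choose (k + f))
        = (N choose k) * (Suc (N - k) choose f)"
      unfolding choose_of_choose by (simp add: f algebra_simps)
    from arg_cong[OF this, of "\<lambda>x. x * ((m - 1) choose g)"] show ?thesis
      by (simp add: f algebra_simps)
  qed
  then have "(\<Sum>f = 1..m. ((k + f - 1) choose (f - 1)) * ((m - 1) choose (f - 1))
                              * (N choose (k + f - 1))
                            + ((k + f) choose f) * ((m - 1) choose (f - 1)) * (N choose (k + f)))
      = (\<Sum>f = 1..m. (N choose k) * ((Suc (N - k) choose f) * ((m - 1) choose (f - 1))))"
    by (rule sum.cong[OF refl])
  then show ?thesis
    by (simp only: sum.distrib sum_distrib_left[symmetric] vandermonde_long_runs[OF assms(1)])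
qed

section \<open>The two summation formulas\<close>

lemma sum_int_atLeastAtMost: "(\<Sum>f = 1..int m. g f) = (\<Sum>f = 1..m. g (int f))"
proof -
  have "{1..int m} = int ` {1..m}"
    by (simp add: image_int_atLeastAtMost)
  then show ?thesis
    by (simp add: sum.reindex)
qed

theorem theorem2p4:
  fixes n k m :: int
  assumes "n \<ge> 3"
    and "0 \<le> k" and "k \<le> n - 1"
    and "0 < m" and "m \<le> n - 1 - k"
  shows "(odd (n + k + m) \<longrightarrow>
           z n k m =
             (\<Sum>f = 1..m. (nat (k + f) choose nat f) * (nat (m - 1) choose nat (f - 1))
                          * z (n - m - f) (k + f) 0)) \<and>
         (even (n + k + m) \<longrightarrow>
           z n k m =
             (\<Sum>f = 1..m. (nat (k + f - 1) choose nat (f - 1)) * (nat (m - 1) choose nat (f - 1))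
                          * z (n - m - f) (k + f - 1) 0)
           + (\<Sum>f = 1..m. (nat (k + f) choose nat f) * (nat (m - 1) choose nat (f - 1))
                          * z (n - m - f) (k + f) 0))"
proof -
  obtain k' m' where km: "k = int k'" "m = int m'"
    using assms nonneg_int_cases by (metis less_imp_le)
  have m': "0 < m'" using assms km by simp
  have to_nat: "nat (int k' + int f) = k' + f" "nat (int k' + int f - 1) = k' + f - 1"
    "nat (int m' - 1) = m' - 1" "nat (int f - 1) = f - 1" for f
    by auto
  \<comment> \<open>The number of runs is \<open>2 d + 2 - e\<close>, where \<open>e = 1\<close> if the last run consists of zeros;
    so there are \<open>d + 1\<close> runs of zeros.\<close>
  define e where "e = (if odd (n + k + m) then 1 else 0 :: int)"
  have e: "e \<in> {0, 1}" by (simp add: e_def)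
  have "even (n - k - m + e - 2)" by (simp add: e_def)
  moreover have "0 \<le> n - k - m + e - 2"
  proof -
    \<comment> \<open>A single run is excluded in the even case by parity alone.\<close>
    have "n - k - m \<noteq> 1" if "even (n + k + m)"
      using that by presburger
    then show ?thesis using assms unfolding e_def by (cases "odd (n + k + m)") simp_all
  qed
  ultimately obtain d where "n - k - m + e - 2 = 2 * int d"
    by (metis dvdE nonneg_int_cases zero_le_mult_iff not_numeral_le_zero)
  then have n: "n = int k' + int m' + 2 * int d + 2 - e" using km by simp
  define N where "N = k' + d"
  have runs: "nat (n - int k' - int m') = 2 * d + 2 - nat e"
    using e n by auto
  have closed: "z n k m = (N choose k') * weak_compositions m' (d + 1 - nat e)"
    using e runs by (auto simp: km z_closed_form Let_def weak_compositions_def N_def)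
  have plain: "z (n - int m' - int f) (int k' + int f) 0 = N choose (k' + f)" for f
    using z_without_one_pairs[OF e, of "n - int m' - int f" N "k' + f"] n by (simp add: N_def)
  have final: "z (n - int m' - int f) (int k' + int f - 1) 0 = N choose (k' + f - 1)"
    if "e = 0" "f \<in> {1..m'}" for f
  proof -
    have K: "int (k' + f - 1) = int k' + int f - 1" using that by auto
    have "n - int m' - int f = 2 * int N + 2 - int (k' + f - 1) - 1"
      unfolding K using n that(1) by (simp add: N_def)
    then show ?thesis
      using z_without_one_pairs[of 1] unfolding K[symmetric] by simp
  qed
  have plain_sum: "(\<Sum>f = 1..m. (nat (k + f) choose nat f) * (nat (m - 1) choose nat (f - 1))
                               * z (n - m - f) (k + f) 0)
      = (\<Sum>f = 1..m'. ((k' + f) choose f) * ((m' - 1) choose (f - 1)) * (N choose (k' + f)))"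
    unfolding km sum_int_atLeastAtMost to_nat nat_int plain ..
  have final_sum: "(\<Sum>f = 1..m. (nat (k + f - 1) choose nat (f - 1))
                               * (nat (m - 1) choose nat (f - 1)) * z (n - m - f) (k + f - 1) 0)
      = (\<Sum>f = 1..m'. ((k' + f - 1) choose (f - 1)) * ((m' - 1) choose (f - 1))
                        * (N choose (k' + f - 1)))" if "e = 0"
    unfolding km sum_int_atLeastAtMost to_nat nat_int
    by (rule sum.cong[OF refl]) (simp only: final[OF that])
  show ?thesis
  proof (cases "odd (n + k + m)")
    case True
    then have "z n k m = (N choose k') * weak_compositions m' (N - k')"
      unfolding closed by (simp add: e_def N_def)
    with True show ?thesis
      unfolding plain_sum sum_choose_long_runs[OF m'] by blast
  next
    case False
    then have "e = 0" by (simp add: e_def)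
    then have "z n k m = (N choose k') * weak_compositions m' (Suc (N - k'))"
      unfolding closed by (simp add: N_def)
    moreover have "k' \<le> N" by (simp add: N_def)
    ultimately show ?thesis
      using False unfolding final_sum[OF \<open>e = 0\<close>] plain_sum
        sum_choose_long_runs_final[OF m' \<open>k' \<le> N\<close>]
      by blast
  qed
qed

end
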